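(* Every nonzero principal ideal has a lower gap in $\mathscr L$: for every nonzero principal ideal $I$ there is an ideal $M\subsetneq I$ (possibly $M=\{0\}$) such that there is no ideal strictly between $M$ and $I$.
   Context: $H$ is a separable infinite-dimensional complex Hilbert space. "Ideal" means a two-sided ideal of $B(H)$ contained in the compact operators, and a principal ideal is one generated by a single operator. $\mathscr L$ is the lattice of all nonzero ideals, ordered by inclusion. A gap in $\mathscr L$ is a nested pair of ideals $M\subsetneq I$ with no ideal of $\mathscr L$ strictly between them, and it is then called a lower gap for $I$; by convention $\{0\}\subset I$ is also called a gap if there is no $L\in\mathscr L$ with $\{0\}\subsetneq L\subsetneq I$. *)

theory Defs
  imports "HOL-Analysis.Analysis" "HOL-Algebra.Ideal"
begin

(* Complex Hilbert spaces.  The real Banach space structure of the library is kept, so that its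
   topology and its type of bounded operators apply; it is tied to the complex structure by
   scaleR_scaleC and norm_eq_sqrt_cinner.  The inner product is linear in the first argument. *)

class complex_hilbert_space = banach +
  fixes scaleC :: "complex \<Rightarrow> 'a \<Rightarrow> 'a" (infixr "*\<^sub>C" 75)
    and cinner :: "'a \<Rightarrow> 'a \<Rightarrow> complex"
  assumes scaleC_add_right: "a *\<^sub>C (x + y) = a *\<^sub>C x + a *\<^sub>C y"
    and scaleC_add_left: "(a + b) *\<^sub>C x = a *\<^sub>C x + b *\<^sub>C x"
    and scaleC_scaleC: "a *\<^sub>C b *\<^sub>C x = (a * b) *\<^sub>C x"
    and scaleR_scaleC: "r *\<^sub>R x = complex_of_real r *\<^sub>C x"
    and cinner_commute: "cinner x y = cnj (cinner y x)"
    and cinner_add_left: "cinner (x + y) z = cinner x z + cinner y z"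
    and cinner_scaleC_left: "cinner (a *\<^sub>C x) y = a * cinner x y"
    and cinner_ge_zero: "0 \<le> Re (cinner x x)"
    and cinner_eq_zero_iff: "cinner x x = 0 \<longleftrightarrow> x = 0"
    and norm_eq_sqrt_cinner: "norm x = sqrt (Re (cinner x x))"

global_interpretation complex_vector:
  vector_space "scaleC :: complex \<Rightarrow> 'a \<Rightarrow> 'a::complex_hilbert_space"
proof
  fix x :: 'a
  show "1 *\<^sub>C x = x"
    using scaleR_scaleC[of 1 x] by simp
qed (simp_all add: scaleC_add_right scaleC_add_left scaleC_scaleC)

definition complex_infinite_dimensional :: "'a::complex_hilbert_space itself \<Rightarrow> bool" where
  "complex_infinite_dimensional _ \<longleftrightarrow>
     \<not> (\<exists>B :: 'a set. finite B \<and> complex_vector.span B = UNIV)"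

(* The ring B(H).  The library type of bounded operators only asks for real linearity, so the
   carrier singles out the complex linear ones. *)

definition bounded_operators :: "('a::complex_hilbert_space \<Rightarrow>\<^sub>L 'a) ring" where
  "bounded_operators =
     \<lparr>carrier = {T. \<forall>c x. blinfun_apply T (c *\<^sub>C x) = c *\<^sub>C blinfun_apply T x},
      monoid.mult = (o\<^sub>L), one = id_blinfun, zero = 0, add = (+)\<rparr>"

lemma ring_bounded_operators: "ring (bounded_operators :: ('a::complex_hilbert_space \<Rightarrow>\<^sub>L 'a) ring)"
proof (rule ringI)
  show "abelian_group (bounded_operators :: ('a \<Rightarrow>\<^sub>L 'a) ring)"
  proof (rule abelian_groupI)
    fix T :: "'a \<Rightarrow>\<^sub>L 'a"
    assume "T \<in> carrier bounded_operators"
    then show "\<exists>S\<in>carrier bounded_operators. S \<oplus>\<^bsub>bounded_operators\<^esub> T = \<zero>\<^bsub>bounded_operators\<^esub>"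
      by (intro bexI[of _ "- T"]) (auto simp: bounded_operators_def blinfun.bilinear_simps)
  qed (auto simp: bounded_operators_def blinfun.bilinear_simps scaleC_add_right)
  show "Group.monoid (bounded_operators :: ('a \<Rightarrow>\<^sub>L 'a) ring)"
    by unfold_locales (auto simp: bounded_operators_def intro!: blinfun_eqI)
qed (auto simp: bounded_operators_def blinfun.bilinear_simps intro!: blinfun_eqI)

definition compact_operator :: "('a::complex_hilbert_space \<Rightarrow>\<^sub>L 'a) \<Rightarrow> bool" where
  "compact_operator T \<longleftrightarrow>
     T \<in> carrier bounded_operators \<and> compact (closure (blinfun_apply T ` cball 0 1))"

definition operator_ideal :: "('a::complex_hilbert_space \<Rightarrow>\<^sub>L 'a) set \<Rightarrow> bool" where
  "operator_ideal I \<longleftrightarrow> ideal I bounded_operators \<and> I \<subseteq> Collect compact_operator"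

definition principal_operator_ideal :: "('a::complex_hilbert_space \<Rightarrow>\<^sub>L 'a) set \<Rightarrow> bool" where
  "principal_operator_ideal I \<longleftrightarrow> operator_ideal I \<and> principalideal I bounded_operators"

definition ideal_lattice :: "('a::complex_hilbert_space \<Rightarrow>\<^sub>L 'a) set set" where
  "ideal_lattice = {I. operator_ideal I \<and> I \<noteq> {0}}"

(* {0} is not a member of the lattice but is admitted as the lower end of a gap. *)

definition lower_gap :: "('a::complex_hilbert_space \<Rightarrow>\<^sub>L 'a) set \<Rightarrow> ('a \<Rightarrow>\<^sub>L 'a) set \<Rightarrow> bool" where
  "lower_gap M I \<longleftrightarrow>
     (M \<in> ideal_lattice \<or> M = {0}) \<and> I \<in> ideal_lattice \<and> M \<subset> I \<and>
     \<not> (\<exists>L\<in>ideal_lattice. M \<subset> L \<and> L \<subset> I)"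

end

theory Submission
  imports Defs "HOL-Algebra.Ring_Divisibility"
begin

(* If T generates I, then an ideal inside I is proper exactly when it omits T.  Omitting T passes to
   unions of chains, so Zorn's lemma gives a maximal proper subideal of I. *)

text \<open>The lower end of a gap below \<open>I\<close> is a maximal proper subideal. It exists
  for the reason that a ring with unit has a maximal ideal, with a generator of \<open>I\<close> in
  the role of the unit. In \<open>bounded_operators\<close>, subideals of \<open>I\<close> inherit
  compactness, so maximality among ring ideals gives maximality in
  \<open>ideal_lattice\<close>.\<close>

lemma (in ring) principalideal_maximal_proper_subideal:
  assumes "principalideal I R" and "I \<noteq> {\<zero>}"
  obtains M where "ideal M R" "M \<subset> I" "\<And>L. ideal L R \<Longrightarrow> M \<subset> L \<Longrightarrow> \<not> L \<subset> I"
proof -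
  obtain t where t: "t \<in> carrier R" and I: "I = Idl {t}"
    using principalideal.generate[OF assms(1)] by blast
  have proper_iff: "L \<subset> I \<longleftrightarrow> L \<subseteq> I \<and> t \<notin> L" if "ideal L R" for L
    using genideal_self'[OF t] genideal_minimal[OF that, of "{t}"] I by blast
  define S where "S = {J. ideal J R \<and> J \<subset> I}"
  have "\<exists>M\<in>S. \<forall>X\<in>S. M \<subseteq> X \<longrightarrow> X = M"
  proof (rule subset_Zorn_nonempty)
    \<comment> \<open>The zero ideal is a proper subideal because \<open>I\<close> is
      nonzero.\<close>
    have "\<zero> \<in> I"
      using assms(1) additive_subgroup.zero_closed ideal.axioms(1) principalideal.axioms(1) by blast
    then show "S \<noteq> {}"
      using assms(2) zeroideal by (auto simp: S_def)
  next
    fix C assume "C \<noteq> {}" and chain: "subset.chain S C"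
    then have "C \<subseteq> S"
      by (simp add: pred_on.chain_def)
    \<comment> \<open>\<open>chain_Union_is_ideal\<close> concerns chains of arbitrary ideals;
      properness of the union is recovered separately, from the absence of \<open>t\<close>.\<close>
    from chain have "subset.chain {J. ideal J R} C"
      by (auto simp: pred_on.chain_def S_def)
    then have "ideal (\<Union>C) R"
      using chain_Union_is_ideal[of C] \<open>C \<noteq> {}\<close> by simp
    moreover have "\<Union>C \<subseteq> I \<and> t \<notin> \<Union>C"
      using \<open>C \<subseteq> S\<close> proper_iff by (auto simp: S_def)
    ultimately show "\<Union>C \<in> S"
      using proper_iff by (simp add: S_def)
  qed
  then obtain M where "M \<in> S" and maximal: "\<And>X. X \<in> S \<Longrightarrow> M \<subseteq> X \<Longrightarrow> X = M"
    by blast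
  then show thesis
    by (intro that[of M]) (auto simp: S_def)
qed

theorem corollary3p4:
  fixes I :: "('h::complex_hilbert_space \<Rightarrow>\<^sub>L 'h) set"
  assumes "separable_space (euclidean :: 'h topology)"
    and "complex_infinite_dimensional TYPE('h)"
    and "principal_operator_ideal I"
    and "I \<noteq> {0}"
  shows "\<exists>M. lower_gap M I"
proof -
  have zero: "\<zero>\<^bsub>bounded_operators\<^esub> = (0 :: 'h \<Rightarrow>\<^sub>L 'h)"
    by (simp add: bounded_operators_def)
  have I: "operator_ideal I" and "principalideal I bounded_operators"
    using assms(3) by (auto simp: principal_operator_ideal_def)
  then have "principalideal I bounded_operators" and "I \<noteq> {\<zero>\<^bsub>bounded_operators\<^esub>}"
    using assms(4) zero by simp_all
  then obtain M where M: "ideal M bounded_operators" "M \<subset> I"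
    and maximal: "\<And>L. ideal L bounded_operators \<Longrightarrow> M \<subset> L \<Longrightarrow> \<not> L \<subset> I"
    by (rule ring.principalideal_maximal_proper_subideal[OF ring_bounded_operators]) blast
  have "operator_ideal M"
    using M I by (auto simp: operator_ideal_def)
  then have "lower_gap M I"
    unfolding lower_gap_def ideal_lattice_def operator_ideal_def
    using M(2) I assms(4) maximal by (simp add: operator_ideal_def)
  then show ?thesis ..
qed

end
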